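(* Let $b$ be a nonzero integer such that $p^2+bq^2$ is irreducible over $\mathbb{Q}$ (i.e. $-b$ is not a square in $\mathbb{Q}$). Let $p_0,q_0,r_0\in\mathbb{Q}$ with $q_0\neq0$ and $r_0\neq 0$, and put $m=p_0^2+bq_0^2$. Suppose that the set of rational points $(v,w)\in\mathbb{Q}^2$ on the curve $$\mathcal{C}_2:\; w^2=2b\,(-m^2+2bq_0^2r_0^2v^2+b^2q_0^4v^4)$$ is infinite. Then the set of rational points on the surface $$V_2:\;(p^2+bq^2)^2=X^4-2r_0^2X^2+(m^2+r_0^4)$$ is infinite too, in the sense that the set of $X$-coordinates of points $(p,q,X)\in V_2(\mathbb{Q})$ is infinite.
   Context: $V_2(\mathbb{Q})$ is the set of rational solutions $(p,q,X)\in\mathbb{Q}^3$ of the displayed equation. Convention: "the set of rational points on the surface is infinite" means that its image under the projection $(p,q,X)\mapsto X$ is infinite. *)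

theory Defs
  imports "HOL-Computational_Algebra.Polynomial_Factorial"
begin

text \<open>
  The binary form \<open>p\<^sup>2 + b q\<^sup>2\<close> as an element of \<open>\<rat>[q][p]\<close>, which is \<open>\<rat>[p, q]\<close>:
  the outer indeterminate is \<open>p\<close> and the inner one is \<open>q\<close>.
\<close>

definition quad_form :: "int \<Rightarrow> rat poly poly" where
  "quad_form b = [: [:0, 0, of_int b:], 0, 1 :]"

lemma poly_quad_form: "poly (poly (quad_form b) [:x:]) y = x\<^sup>2 + of_int b * y\<^sup>2"
  by (simp add: quad_form_def power2_eq_square algebra_simps)

lemma irreducible_quad_form_iff:
  "irreducible (quad_form b) \<longleftrightarrow> \<not> (\<exists>s::rat. s\<^sup>2 = - of_int b)"
proof
  assume irr: "irreducible (quad_form b)"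
  show "\<not> (\<exists>s::rat. s\<^sup>2 = - of_int b)"
  proof
    assume "\<exists>s::rat. s\<^sup>2 = - of_int b"
    then obtain s :: rat where s: "s * s = - of_int b"
      by (auto simp: power2_eq_square)
    have "quad_form b = [: [:0, s:], 1 :] * [: [:0, - s:], 1 :]"
      by (simp add: quad_form_def s)
    with irr have "[: [:0, s:], 1 :] dvd 1 \<or> [: [:0, - s:], 1 :] dvd 1"
      by (blast dest: irreducibleD)
    then show False
      by (auto simp: is_unit_poly_iff)
  qed
next
  assume nsq: "\<not> (\<exists>s::rat. s\<^sup>2 = - of_int b)"
  show "irreducible (quad_form b)"
  proof (rule irreducibleI)
    show "quad_form b \<noteq> 0" by (simp add: quad_form_def)
    show "\<not> quad_form b dvd 1" by (auto simp: quad_form_def is_unit_poly_iff)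
    fix f g assume fg: "quad_form b = f * g"
    have lc: "lead_coeff f * lead_coeff g = 1"
      using arg_cong[OF fg, of lead_coeff] by (simp add: quad_form_def lead_coeff_mult)
    have "f \<noteq> 0" "g \<noteq> 0" using fg by (auto simp: quad_form_def)
    then have deg: "degree f + degree g = 2"
      using arg_cong[OF fg, of degree] by (simp add: quad_form_def degree_mult_eq)
    have unit: "h dvd 1" if "degree h = 0" "lead_coeff h dvd 1" for h :: "rat poly poly"
      using that by (metis degree_eq_zeroE is_unit_poly_iff lead_coeff_pCons(2))
    consider "degree f = 0" | "degree g = 0" | "degree f = 1" "degree g = 1"
      using deg by linarith
    then show "f dvd 1 \<or> g dvd 1"
    proof cases
      case 1 then show ?thesis using unit[of f] lc by (metis dvd_triv_left)
    next
      case 2 then show ?thesis using unit[of g] lc by (metis dvd_triv_right)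
    next
      case 3
      obtain f0 f1 where f: "f = [:f0, f1:]" using 3(1) by (metis degree_0 degree_eq_zeroE degree_pCons_eq_if diff_Suc_1 pCons_cases zero_neq_one One_nat_def)
      obtain g0 g1 where g: "g = [:g0, g1:]" using 3(2) by (metis degree_0 degree_eq_zeroE degree_pCons_eq_if diff_Suc_1 pCons_cases zero_neq_one One_nat_def)
      have e: "f1 * g1 = 1" "f0 * g1 + f1 * g0 = 0" "f0 * g0 = [:0, 0, of_int b:]"
        using fg lc 3 by (auto simp: quad_form_def f g algebra_simps split: if_splits)
      have e': "poly f1 1 * poly g1 1 = 1" "poly f0 1 * poly g1 1 + poly f1 1 * poly g0 1 = 0"
        "poly f0 1 * poly g0 1 = of_int b"
        using e[THEN arg_cong, of "\<lambda>h. poly h 1"] by simp_all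
      have "(poly f0 1 * poly g1 1)\<^sup>2 = - of_int b"
        using e' by algebra
      with nsq show ?thesis by blast
    qed
  qed
qed

definition C2_points :: "int \<Rightarrow> rat \<Rightarrow> rat \<Rightarrow> rat \<Rightarrow> (rat \<times> rat) set" where
  "C2_points b m q0 r0 = {(v, w).
     w\<^sup>2 = 2 * of_int b * (- m\<^sup>2 + 2 * of_int b * q0\<^sup>2 * r0\<^sup>2 * v\<^sup>2 + (of_int b)\<^sup>2 * q0^4 * v^4)}"

definition V2_points :: "int \<Rightarrow> rat \<Rightarrow> rat \<Rightarrow> (rat \<times> rat \<times> rat) set" where
  "V2_points b m r0 = {(p, q, X).
     (p\<^sup>2 + of_int b * q\<^sup>2)\<^sup>2 = X^4 - 2 * r0\<^sup>2 * X\<^sup>2 + (m\<^sup>2 + r0^4)}"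

end

theory Submission imports Defs begin

text \<open>
  Write \<open>r = r\<^sub>0\<close>, \<open>u = q\<^sub>0 v\<close> and \<open>Y = p\<^sup>2 + b q\<^sup>2\<close>. The equation of the surface is
  \<open>Y\<^sup>2 = (X\<^sup>2 - r\<^sup>2)\<^sup>2 + m\<^sup>2\<close>, which in terms of \<open>V = Y + X\<^sup>2 - r\<^sup>2\<close> becomes
  \<open>X\<^sup>2 = (V\<^sup>2 + 2 r\<^sup>2 V - m\<^sup>2) / (2 V)\<close> and \<open>Y = (V\<^sup>2 + m\<^sup>2) / (2 V)\<close>. With \<open>x = 2 V\<close> and
  \<open>y = 4 V X\<close> this is the elliptic curve \<open>y\<^sup>2 = x (x\<^sup>2 + 4 r\<^sup>2 x - 4 m\<^sup>2)\<close>, and the only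
  remaining condition is that \<open>Y\<close> be represented by the form \<open>p\<^sup>2 + b q\<^sup>2\<close>, that is, be a norm.

  The class of \<open>x\<close> modulo squares is a homomorphism on the rational points. If
  \<open>x = m b\<close> modulo squares, say \<open>V = 2 m b s\<^sup>2\<close>, then \<open>Y\<close> is automatically a norm: it equals
  \<open>m (1 + 4 b\<^sup>2 s\<^sup>4) / (4 b s\<^sup>2)\<close>, where \<open>m\<close> is a norm by hypothesis, \<open>b\<close> is the norm with
  \<open>p = 0\<close> and \<open>q = 1\<close>, and \<open>1 + 4 b\<^sup>2 s\<^sup>4 = (1 - 2 b s\<^sup>2)\<^sup>2 + b (2 s)\<^sup>2\<close>
  (lemma \<open>norm_square_from_parameter\<close>).

  A point of \<open>\<C>\<^sub>2\<close> is a point of the elliptic curve with \<open>V = b u\<^sup>2\<close>, so \<open>x\<close> has the class of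
  \<open>2 b\<close>. The point \<open>X = r\<close>, \<open>Y = m\<close> has \<open>x = 2 m\<close>. Their sum therefore has the class of \<open>m b\<close>,
  as wanted. The third point on the chord through them, which is
  the negative of the sum and has the same \<open>x\<close>, is given by
  \<open>s = (2 r b u - w) / (2 b (b u\<^sup>2 - m))\<close> and \<open>X = r + u (1 - 2 b s\<^sup>2) / (2 s)\<close>
  (lemmas \<open>chord_relation\<close> and \<open>chord_X\<close>).

  Finally \<open>X\<close> determines \<open>s\<close> up to finitely many values because \<open>m \<noteq> 0\<close>, and \<open>s\<close> determines
  \<open>u\<close> up to two values because \<open>r \<noteq> 0\<close>; hence infinitely many points on \<open>\<C>\<^sub>2\<close> yield
  infinitely many \<open>X\<close>.
\<close>

section \<open>Adding the base point to a point of the curve\<close>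

text \<open>
  Substituting the chord \<open>w = 2 r b u - 2 b s (b u\<^sup>2 - m)\<close> in the quartic, the terms in \<open>r\<^sup>2\<close>
  cancel and \<open>b u\<^sup>2 - m\<close> splits off, since the base point lies on the chord. What is left is only
  quadratic in \<open>u\<close>.
\<close>

lemma chord_relation:
  fixes b m r s u w :: "'a::field_char_0"
  assumes curve: "w\<^sup>2 = 2 * b * (- m\<^sup>2 + 2 * b * r\<^sup>2 * u\<^sup>2 + b\<^sup>2 * u^4)"
    and chord: "2 * b * s * (b * u\<^sup>2 - m) = 2 * r * b * u - w"
    and nz: "b \<noteq> 0" "b * u\<^sup>2 \<noteq> m"
  shows "b * (1 - 2 * b * s\<^sup>2) * u\<^sup>2 + 4 * b * r * s * u + m * (1 + 2 * b * s\<^sup>2) = 0"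
    (is "?R = 0")
proof -
  have w: "w = 2 * r * b * u - 2 * b * s * (b * u\<^sup>2 - m)"
    using chord by (simp add: algebra_simps)
  have "2 * b * (b * u\<^sup>2 - m) * ?R
      = 2 * b * (- m\<^sup>2 + 2 * b * r\<^sup>2 * u\<^sup>2 + b\<^sup>2 * u^4) - w\<^sup>2"
    unfolding w by algebra
  also have "\<dots> = 0" using curve by simp
  finally show ?thesis using nz by simp
qed

text \<open>
  The right-hand side is \<open>2 b s\<^sup>2 (V - m\<^sup>2 / V)\<close> for \<open>V = 2 m b s\<^sup>2 \<noteq> 0\<close>: this is the point of the
  elliptic curve with parameter \<open>s\<close>, in a form without denominators.
\<close>

lemma chord_X:
  fixes b m r s u :: "'a::field_char_0"
  assumes rel: "b * (1 - 2 * b * s\<^sup>2) * u\<^sup>2 + 4 * b * r * s * u + m * (1 + 2 * b * s\<^sup>2) = 0"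
    and s: "s \<noteq> 0"
    and X: "X = r + u * (1 - 2 * b * s\<^sup>2) / (2 * s)"
  shows "4 * b * s\<^sup>2 * (X\<^sup>2 - r\<^sup>2) = m * (4 * b\<^sup>2 * s^4 - 1)"
proof -
  have "2 * s * X = 2 * s * r + u * (1 - 2 * b * s\<^sup>2)"
    using s by (simp add: X field_simps)
  with rel show ?thesis by algebra
qed

section \<open>The resulting value is represented by the form\<close>

text \<open>
  Brahmagupta's identity composes \<open>m\<close> with \<open>1 + 4 b\<^sup>2 s\<^sup>4\<close> into \<open>A\<^sup>2 + b B\<^sup>2\<close>; dividing by
  \<open>4 b s\<^sup>2 = (2 b s)\<^sup>2 / b\<close> interchanges the roles of \<open>A\<close> and \<open>B\<close>, because \<open>1 / b\<close> is itself a norm.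
\<close>

lemma norm_square_from_parameter:
  fixes b m r s X p0 q0 :: "'a::field_char_0"
  assumes b: "b \<noteq> 0" and s: "s \<noteq> 0"
    and m: "m = p0\<^sup>2 + b * q0\<^sup>2"
    and X: "4 * b * s\<^sup>2 * (X\<^sup>2 - r\<^sup>2) = m * (4 * b\<^sup>2 * s^4 - 1)"
  shows "\<exists>p q. (p\<^sup>2 + b * q\<^sup>2)\<^sup>2 = X^4 - 2 * r\<^sup>2 * X\<^sup>2 + (m\<^sup>2 + r^4)"
proof -
  define A where "A = p0 * (1 - 2 * b * s\<^sup>2) - 2 * b * s * q0"
  define B where "B = 2 * s * p0 + q0 * (1 - 2 * b * s\<^sup>2)"
  define Y where "Y = (B / (2 * s))\<^sup>2 + b * (A / (2 * b * s))\<^sup>2"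
  have "4 * b * s\<^sup>2 * Y = A\<^sup>2 + b * B\<^sup>2"
    using b s by (simp add: Y_def field_simps power2_eq_square)
  also have "\<dots> = m * (1 + 4 * b\<^sup>2 * s^4)"
    unfolding A_def B_def m by algebra
  finally have Y: "4 * b * s\<^sup>2 * Y = m * (1 + 4 * b\<^sup>2 * s^4)" .
  have "(4 * b * s\<^sup>2)\<^sup>2 * (Y\<^sup>2 - (X\<^sup>2 - r\<^sup>2)\<^sup>2)
      = (4 * b * s\<^sup>2 * Y)\<^sup>2 - (4 * b * s\<^sup>2 * (X\<^sup>2 - r\<^sup>2))\<^sup>2"
    by algebra
  also have "\<dots> = (4 * b * s\<^sup>2)\<^sup>2 * m\<^sup>2"
    unfolding X Y by algebra
  finally have "Y\<^sup>2 - (X\<^sup>2 - r\<^sup>2)\<^sup>2 = m\<^sup>2"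
    using b s by simp
  then have "Y\<^sup>2 = X^4 - 2 * r\<^sup>2 * X\<^sup>2 + (m\<^sup>2 + r^4)"
    by algebra
  then show ?thesis
    unfolding Y_def by blast
qed

section \<open>Finiteness of the fibres\<close>

lemma finite_quadratic_roots:
  fixes a b c :: "'a::idom"
  assumes "a \<noteq> 0 \<or> b \<noteq> 0 \<or> c \<noteq> 0"
  shows "finite {x. a * x\<^sup>2 + b * x + c = 0}"
proof -
  have "finite {x. poly [:c, b, a:] x = 0}"
    using assms by (intro poly_roots_finite) auto
  then show ?thesis
    by (simp add: algebra_simps power2_eq_square)
qed

lemma finite_parameters_over_X:
  fixes b m r X :: "'a::field_char_0"
  assumes "m \<noteq> 0"
  shows "finite {s. 4 * b * s\<^sup>2 * (X\<^sup>2 - r\<^sup>2) = m * (4 * b\<^sup>2 * s^4 - 1)}" (is "finite ?S")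
proof -
  have "finite {s. poly [:- m, 0, - 4 * b * (X\<^sup>2 - r\<^sup>2), 0, 4 * b\<^sup>2 * m:] s = 0}"
    using assms by (intro poly_roots_finite) auto
  moreover have "?S \<subseteq> {s. poly [:- m, 0, - 4 * b * (X\<^sup>2 - r\<^sup>2), 0, 4 * b\<^sup>2 * m:] s = 0}"
  proof
    fix s assume "s \<in> ?S"
    then have "4 * b * s\<^sup>2 * (X\<^sup>2 - r\<^sup>2) = m * (4 * b\<^sup>2 * s^4 - 1)" by simp
    then have "- m + s * (s * (- 4 * b * (X\<^sup>2 - r\<^sup>2) + s * (s * (4 * b\<^sup>2 * m)))) = 0"
      by algebra
    then show "s \<in> {s. poly [:- m, 0, - 4 * b * (X\<^sup>2 - r\<^sup>2), 0, 4 * b\<^sup>2 * m:] s = 0}"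
      by (simp add: algebra_simps)
  qed
  ultimately show ?thesis by (rule finite_subset[rotated])
qed

text \<open>
  The leading coefficient vanishes if \<open>2 b s\<^sup>2 = 1\<close>; the linear one, \<open>4 b r s\<close>, never does.
\<close>

lemma finite_u_over_parameter:
  fixes b m r s :: "'a::field_char_0"
  assumes "b \<noteq> 0" "r \<noteq> 0" "s \<noteq> 0"
  shows "finite {u. b * (1 - 2 * b * s\<^sup>2) * u\<^sup>2 + 4 * b * r * s * u + m * (1 + 2 * b * s\<^sup>2) = 0}"
  using assms by (intro finite_quadratic_roots) auto

section \<open>Infinitely many points\<close>

theorem theorem3p7:
  fixes b :: int and p0 q0 r0 m :: rat
  assumes "b \<noteq> 0"
    and "irreducible (quad_form b)"
    and "q0 \<noteq> 0"
    and "r0 \<noteq> 0"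
    and "m = p0\<^sup>2 + of_int b * q0\<^sup>2"
    and "infinite (C2_points b m q0 r0)"
  shows "infinite {X. \<exists>p q. (p, q, X) \<in> V2_points b m r0}"
proof
  define c :: rat where "c = of_int b"
  define XS where "XS = {X. \<exists>p q. (p, q, X) \<in> V2_points b m r0}"
  assume "finite {X. \<exists>p q. (p, q, X) \<in> V2_points b m r0}"
  then have fin_XS: "finite XS" by (simp add: XS_def)
  have c: "c \<noteq> 0" using assms(1) by (simp add: c_def)
  have m: "m = p0\<^sup>2 + c * q0\<^sup>2" using assms(5) by (simp add: c_def)
  have m0: "m \<noteq> 0"
  proof
    assume "m = 0"
    then have "(p0 / q0)\<^sup>2 = - c"
      using m assms(3) by (simp add: field_simps eq_neg_iff_add_eq_0)
    then show False
      using assms(2) by (auto simp: irreducible_quad_form_iff c_def)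
  qed
  let ?on_curve = "\<lambda>u w. w\<^sup>2 = 2 * c * (- m\<^sup>2 + 2 * c * r0\<^sup>2 * u\<^sup>2 + c\<^sup>2 * u^4)"
  let ?rel = "\<lambda>s u. c * (1 - 2 * c * s\<^sup>2) * u\<^sup>2 + 4 * c * r0 * s * u
                      + m * (1 + 2 * c * s\<^sup>2) = 0"
  define SS where
    "SS = (\<Union>X\<in>XS. {s. 4 * c * s\<^sup>2 * (X\<^sup>2 - r0\<^sup>2) = m * (4 * c\<^sup>2 * s^4 - 1)}) - {0}"
  \<comment> \<open>If \<open>c u\<^sup>2 = m\<close>, the point has the same \<open>x\<close> as the base point, so no chord formula applies;
      if \<open>c u\<^sup>2 = - m\<close>, the sum can be \<open>x = 0\<close>, which gives no value of \<open>X\<close>.\<close>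
  define US where
    "US = {u. c * u\<^sup>2 = m} \<union> {u. c * u\<^sup>2 = - m}
          \<union> (\<Union>s\<in>SS. {u. ?rel s u})"
  have "finite SS"
    unfolding SS_def using fin_XS finite_parameters_over_X[OF m0] by simp
  moreover have "finite {u. ?rel s u}" if "s \<in> SS" for s
    using that c assms(4) by (intro finite_u_over_parameter) (auto simp: SS_def)
  moreover have "finite {u. c * u\<^sup>2 = d}" for d
    using finite_quadratic_roots[of c 0 "- d"] c by simp
  ultimately have fin_US: "finite US"
    unfolding US_def by blast
  have in_US: "u \<in> US" if curve: "?on_curve u w" for u w
  proof (cases "c * u\<^sup>2 = m \<or> c * u\<^sup>2 = - m")
    case True
    then show ?thesis by (auto simp: US_def)
  next
    case False
    define s where "s = (2 * r0 * c * u - w) / (2 * c * (c * u\<^sup>2 - m))"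
    define X where "X = r0 + u * (1 - 2 * c * s\<^sup>2) / (2 * s)"
    have chord: "2 * c * s * (c * u\<^sup>2 - m) = 2 * r0 * c * u - w"
      using False c by (simp add: s_def)
    have rel: "?rel s u"
      using chord_relation[OF curve chord c] False by blast
    \<comment> \<open>At \<open>s = 0\<close> the relation degenerates to \<open>c u\<^sup>2 + m = 0\<close>.\<close>
    have s0: "s \<noteq> 0"
      using rel False by (auto simp: eq_neg_iff_add_eq_0)
    have X: "4 * c * s\<^sup>2 * (X\<^sup>2 - r0\<^sup>2) = m * (4 * c\<^sup>2 * s^4 - 1)"
      using chord_X[OF rel s0 X_def] .
    have "X \<in> XS"
      using norm_square_from_parameter[OF c s0 m X]
      by (simp add: XS_def V2_points_def c_def)
    then have "s \<in> SS"
      using X s0 by (auto simp: SS_def)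
    then show ?thesis
      using rel by (auto simp: US_def)
  qed
  define WS where "WS = (\<lambda>u. {w. ?on_curve u w})"
  have "finite (WS u)" for u
    using finite_quadratic_roots[of 1 0 "- (2 * c * (- m\<^sup>2 + 2 * c * r0\<^sup>2 * u\<^sup>2 + c\<^sup>2 * u^4))"]
    by (simp add: WS_def)
  then have "finite (Sigma US WS)"
    using fin_US by blast
  moreover have "C2_points b m q0 r0 \<subseteq> (\<lambda>(u, w). (u / q0, w)) ` Sigma US WS"
  proof
    fix z assume "z \<in> C2_points b m q0 r0"
    then obtain v w where z: "z = (v, w)"
      and vw: "w\<^sup>2 = 2 * c * (- m\<^sup>2 + 2 * c * q0\<^sup>2 * r0\<^sup>2 * v\<^sup>2 + c\<^sup>2 * q0^4 * v^4)"
      by (auto simp: C2_points_def c_def)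
    have curve: "?on_curve (q0 * v) w"
      unfolding vw by (simp add: power_mult_distrib mult_ac)
    have "(q0 * v, w) \<in> Sigma US WS"
      using in_US[OF curve] curve by (simp add: WS_def)
    moreover have "z = (\<lambda>(u, w). (u / q0, w)) (q0 * v, w)"
      using z assms(3) by simp
    ultimately show "z \<in> (\<lambda>(u, w). (u / q0, w)) ` Sigma US WS"
      by blast
  qed
  ultimately have "finite (C2_points b m q0 r0)"
    by (meson finite_imageI finite_subset)
  with assms(6) show False ..
qed

end
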